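(* Every finite distributive lattice $D$ can be represented as the congruence lattice of a finite isoform lattice: for every finite distributive lattice $D$ there exists a finite isoform lattice $L$ such that the congruence lattice $\operatorname{Con} L$ is isomorphic to $D$.
   Context: Let $L$ be a lattice. $\operatorname{Con} L$ denotes the lattice of all congruence relations of $L$. A congruence relation $\Theta$ of $L$ is called isoform if any two congruence classes of $\Theta$ are isomorphic as lattices (each congruence class being regarded as a sublattice of $L$). The lattice $L$ is called isoform if all congruences of $L$ are isoform. *)

theory Defs
  imports "HOL-Algebra.Complete_Lattice"
begin

text \<open>Lattices are the carrier-based ones of \<^locale>\<open>lattice\<close>. That locale admits an empty
  carrier, so nonemptiness has to be assumed separately.\<close>

locale distributive_lattice = lattice +
  assumes meet_join_distrib:
    "\<lbrakk>x \<in> carrier L; y \<in> carrier L; z \<in> carrier L\<rbrakk> \<Longrightarrow> x \<sqinter> (y \<squnion> z) = (x \<sqinter> y) \<squnion> (x \<sqinter> z)"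

definition lattice_iso :: "('a, 'c) gorder_scheme \<Rightarrow> ('b, 'd) gorder_scheme \<Rightarrow> ('a \<Rightarrow> 'b) set" where
  "lattice_iso A B = {f. bij_betw f (carrier A) (carrier B) \<and> join_pres A B f \<and> meet_pres A B f}"

definition lattice_isomorphic :: "('a, 'c) gorder_scheme \<Rightarrow> ('b, 'd) gorder_scheme \<Rightarrow> bool" where
  "lattice_isomorphic A B \<longleftrightarrow> lattice_iso A B \<noteq> {}"

definition lattice_congruence :: "('a, 'c) gorder_scheme \<Rightarrow> ('a \<times> 'a) set \<Rightarrow> bool" where
  "lattice_congruence L \<Theta> \<longleftrightarrow> equiv (carrier L) \<Theta> \<and>
     (\<forall>a b c d. (a, b) \<in> \<Theta> \<longrightarrow> (c, d) \<in> \<Theta> \<longrightarrow>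
        (a \<squnion>\<^bsub>L\<^esub> c, b \<squnion>\<^bsub>L\<^esub> d) \<in> \<Theta> \<and> (a \<sqinter>\<^bsub>L\<^esub> c, b \<sqinter>\<^bsub>L\<^esub> d) \<in> \<Theta>)"

definition Con :: "('a, 'c) gorder_scheme \<Rightarrow> ('a \<times> 'a) set gorder" where
  "Con L = \<lparr>carrier = {\<Theta>. lattice_congruence L \<Theta>}, eq = (=), le = (\<subseteq>)\<rparr>"

text \<open>A congruence class \<open>X\<close> is regarded as a lattice by restricting the order of \<open>L\<close> to it;
  the lemma \<open>congruence_class_sublattice\<close> below shows that the joins and meets computed in
  \<open>L\<lparr>carrier := X\<rparr>\<close> are those of \<open>L\<close>.\<close>

definition isoform_congruence :: "('a, 'c) gorder_scheme \<Rightarrow> ('a \<times> 'a) set \<Rightarrow> bool" where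
  "isoform_congruence L \<Theta> \<longleftrightarrow>
     (\<forall>X \<in> carrier L // \<Theta>. \<forall>Y \<in> carrier L // \<Theta>.
        lattice_isomorphic (L\<lparr>carrier := X\<rparr>) (L\<lparr>carrier := Y\<rparr>))"

definition isoform_lattice :: "('a, 'c) gorder_scheme \<Rightarrow> bool" where
  "isoform_lattice L \<longleftrightarrow> lattice L \<and> (\<forall>\<Theta> \<in> carrier (Con L). isoform_congruence L \<Theta>)"

lemma restrict_sublattice:
  fixes L (structure)
  assumes "lattice L" and sub: "X \<subseteq> carrier L"
    and cl: "\<And>x y. x \<in> X \<Longrightarrow> y \<in> X \<Longrightarrow> x \<squnion> y \<in> X \<and> x \<sqinter> y \<in> X"
  shows "lattice (L\<lparr>carrier := X\<rparr>)"
    and "\<And>x y. x \<in> X \<Longrightarrow> y \<in> X \<Longrightarrow> x \<squnion>\<^bsub>L\<lparr>carrier := X\<rparr>\<^esub> y = x \<squnion> y"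
    and "\<And>x y. x \<in> X \<Longrightarrow> y \<in> X \<Longrightarrow> x \<sqinter>\<^bsub>L\<lparr>carrier := X\<rparr>\<^esub> y = x \<sqinter> y"
proof -
  interpret lattice L by fact
  let ?X = "L\<lparr>carrier := X\<rparr>"
  have inL: "x \<in> carrier L" if "x \<in> X" for x using that sub by blast
  have lub: "is_lub ?X (x \<squnion> y) {x, y}" if "x \<in> X" "y \<in> X" for x y
    using that cl[OF that] inL join_left join_right
    by (auto simp: least_def Upper_def intro!: join_le)
  have glb: "is_glb ?X (x \<sqinter> y) {x, y}" if "x \<in> X" "y \<in> X" for x y
    using that cl[OF that] inL meet_left meet_right
    by (auto simp: greatest_def Lower_def intro!: meet_le)
  have po: "partial_order ?X"
    by unfold_locales (auto simp: eq_is_equal inL intro: le_antisym le_trans)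
  show lat: "lattice ?X"
  proof -
    interpret X: partial_order ?X by (rule po)
    show ?thesis
    proof
      fix x y assume "x \<in> carrier ?X" "y \<in> carrier ?X"
      then have xy: "x \<in> X" "y \<in> X" by simp_all
      show "\<exists>s. is_lub ?X s {x, y}" using lub[OF xy] by blast
      show "\<exists>s. is_glb ?X s {x, y}" using glb[OF xy] by blast
    qed
  qed
  interpret X: lattice ?X by (rule lat)
  show "x \<squnion>\<^bsub>?X\<^esub> y = x \<squnion> y" if "x \<in> X" "y \<in> X" for x y
    using X.least_unique[OF _ lub[OF that]] X.sup_of_two_least[of x y] that
    by (simp add: join_def)
  show "x \<sqinter>\<^bsub>?X\<^esub> y = x \<sqinter> y" if "x \<in> X" "y \<in> X" for x y
    using X.greatest_unique[OF _ glb[OF that]] X.inf_of_two_greatest[of x y] that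
    by (simp add: meet_def)
qed

lemma congruence_class_sublattice:
  fixes L (structure)
  assumes L: "lattice L" and \<Theta>: "lattice_congruence L \<Theta>" and X: "X \<in> carrier L // \<Theta>"
  shows "lattice (L\<lparr>carrier := X\<rparr>)"
    and "\<And>x y. x \<in> X \<Longrightarrow> y \<in> X \<Longrightarrow> x \<squnion>\<^bsub>L\<lparr>carrier := X\<rparr>\<^esub> y = x \<squnion> y"
    and "\<And>x y. x \<in> X \<Longrightarrow> y \<in> X \<Longrightarrow> x \<sqinter>\<^bsub>L\<lparr>carrier := X\<rparr>\<^esub> y = x \<sqinter> y"
proof -
  interpret lattice L by fact
  have eqv: "equiv (carrier L) \<Theta>" using \<Theta> by (simp add: lattice_congruence_def)
  have sub: "X \<subseteq> carrier L" using in_quotient_imp_subset[OF eqv X] .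
  have cl: "x \<squnion> y \<in> X \<and> x \<sqinter> y \<in> X" if "x \<in> X" "y \<in> X" for x y
  proof -
    have xy: "(x, y) \<in> \<Theta>" "(x, x) \<in> \<Theta>" 
      using in_quotient_imp_in_rel[OF eqv X] that by auto
    have xL: "x \<in> carrier L" using that sub by blast
    have "x \<squnion> x = x" "x \<sqinter> x = x"
      using xL by (auto intro!: le_antisym join_le meet_le join_left meet_left)
    with xy \<Theta> have "(x, x \<squnion> y) \<in> \<Theta>" "(x, x \<sqinter> y) \<in> \<Theta>"
      unfolding lattice_congruence_def by metis+
    then show ?thesis using in_quotient_imp_closed[OF eqv X \<open>x \<in> X\<close>] by blast
  qed
  show "lattice (L\<lparr>carrier := X\<rparr>)"
    and "\<And>x y. x \<in> X \<Longrightarrow> y \<in> X \<Longrightarrow> x \<squnion>\<^bsub>L\<lparr>carrier := X\<rparr>\<^esub> y = x \<squnion> y"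
    and "\<And>x y. x \<in> X \<Longrightarrow> y \<in> X \<Longrightarrow> x \<sqinter>\<^bsub>L\<lparr>carrier := X\<rparr>\<^esub> y = x \<sqinter> y"
    using restrict_sublattice[OF L sub cl] by auto
qed

lemma Con_complete_lattice:
  fixes L (structure)
  assumes "lattice L"
  shows "complete_lattice (Con L)"
proof -
  interpret lattice L by fact
  interpret C: partial_order "Con L"
    by unfold_locales (auto simp: Con_def)
  have total: "lattice_congruence L (carrier L \<times> carrier L)"
    by (auto simp: lattice_congruence_def equiv_def refl_on_def sym_def trans_def)
  have Int: "lattice_congruence L (\<Inter>A)" if "A \<subseteq> Collect (lattice_congruence L)" "A \<noteq> {}" for A
  proof -
    have c: "lattice_congruence L \<Theta>" if "\<Theta> \<in> A" for \<Theta> using that \<open>A \<subseteq> _\<close> by blast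
    then have e: "equiv (carrier L) \<Theta>" if "\<Theta> \<in> A" for \<Theta>
      using that by (simp add: lattice_congruence_def)
    have "equiv (carrier L) (\<Inter>A)"
    proof (rule equivI)
      show "\<Inter>A \<subseteq> carrier L \<times> carrier L" 
        using e \<open>A \<noteq> {}\<close> by (auto dest!: equiv_type)
      show "refl_on (carrier L) (\<Inter>A)" using e \<open>A \<noteq> {}\<close>
        by (auto simp: refl_on_def equiv_def)
      show "sym (\<Inter>A)" using e by (auto simp: equiv_def sym_def)
      show "trans (\<Inter>A)"
        by (rule transI) (use e in \<open>auto simp: equiv_def intro: transD\<close>)
    qed
    then show ?thesis using c by (simp add: lattice_congruence_def)
  qed
  show ?thesis
  proof (rule C.complete_lattice_criterion1)
    show "\<exists>g. greatest (Con L) g (carrier (Con L))"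
      by (rule exI[of _ "carrier L \<times> carrier L"])
        (use total in \<open>auto simp: greatest_def Con_def lattice_congruence_def dest: equiv_type\<close>)
    show "\<exists>i. is_glb (Con L) i A" if "A \<subseteq> carrier (Con L)" "A \<noteq> {}" for A
      by (rule exI[of _ "\<Inter>A"])
        (use that Int[of A] in \<open>auto simp: greatest_def Lower_def Con_def\<close>)
  qed
qed

end

theory Submission
  imports Defs
begin

text \<open>Let \<open>P\<close> be the poset of join-prime elements of \<open>D\<close>. The lattice \<open>L\<close> consists of all functions from \<open>P\<close>
  to a set \<open>S\<close> of five elements, two of which are called \<open>bot\<close> and \<open>top\<close>, ordered by letting \<open>x \<le> y\<close>
  iff each \<open>p\<close> satisfies \<open>x p = bot\<close>, or \<open>y p = top\<close>, or \<open>x\<close> and \<open>y\<close> agree on the up-set of \<open>p\<close>. For a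
  singleton \<open>P\<close> this is the simple lattice \<open>M\<^sub>3\<close>. The coordinates of a join at \<open>p\<close> depend only on
  the arguments above \<open>p\<close>, so ``agreeing off \<open>H\<close>'' is a congruence for every down-set \<open>H\<close>, and its
  classes are isomorphic because the coordinates off \<open>H\<close> can be overwritten at will. Conversely, a
  congruence that relates two functions differing at \<open>q\<close> but at no larger index identifies all
  functions that agree off the down-set of \<open>q\<close>. So \<open>Con L\<close> is the lattice of down-sets of \<open>P\<close>, which
  is \<open>D\<close> by Birkhoff's theorem.\<close>

section \<open>The ordered set of functions, its joins and its meets\<close>

locale flat_power =
  fixes P :: "'p set" and ord :: "'p \<Rightarrow> 'p \<Rightarrow> bool" (infix \<open>\<preceq>\<close> 50)
    and S :: "'s set" and bot top :: 's
  assumes finite_P: "finite P"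
    and ord_refl: "p \<in> P \<Longrightarrow> p \<preceq> p"
    and ord_antisym: "p \<in> P \<Longrightarrow> q \<in> P \<Longrightarrow> p \<preceq> q \<Longrightarrow> q \<preceq> p \<Longrightarrow> p = q"
    and ord_trans: "p \<in> P \<Longrightarrow> q \<in> P \<Longrightarrow> r \<in> P \<Longrightarrow> p \<preceq> q \<Longrightarrow> q \<preceq> r \<Longrightarrow> p \<preceq> r"
    and bot_S: "bot \<in> S" and top_S: "top \<in> S" and bot_neq_top: "bot \<noteq> top"
    and card_S: "5 \<le> card S"
begin

definition F :: "('p \<Rightarrow> 's) set" where
  "F = P \<rightarrow>\<^sub>E S"

definition agree :: "('p \<Rightarrow> 's) \<Rightarrow> ('p \<Rightarrow> 's) \<Rightarrow> 'p \<Rightarrow> bool" where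
  "agree x y p \<longleftrightarrow> (\<forall>q\<in>P. p \<preceq> q \<longrightarrow> x q = y q)"

text \<open>This is \<open>cle\<close> confined to the up-set of \<open>p\<close>. The join at
  \<open>p\<close> has to be decided by that part of its arguments alone.\<close>

definition le_above :: "('p \<Rightarrow> 's) \<Rightarrow> ('p \<Rightarrow> 's) \<Rightarrow> 'p \<Rightarrow> bool" where
  "le_above x y p \<longleftrightarrow> (\<forall>q\<in>P. p \<preceq> q \<longrightarrow> x q = bot \<or> y q = top \<or> agree x y q)"

definition cle :: "('p \<Rightarrow> 's) \<Rightarrow> ('p \<Rightarrow> 's) \<Rightarrow> bool" where
  "cle x y \<longleftrightarrow> (\<forall>p\<in>P. x p = bot \<or> y p = top \<or> agree x y p)"

text \<open>Two arguments that are \<open>bot\<close> at \<open>p\<close> may be incomparable above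
  \<open>p\<close>; without the first case the value would then be \<open>top\<close>, while the
  least upper bound has \<open>bot\<close> there.\<close>

definition jn :: "('p \<Rightarrow> 's) \<Rightarrow> ('p \<Rightarrow> 's) \<Rightarrow> 'p \<Rightarrow> 's" where
  "jn x y = (\<lambda>p\<in>P. if x p = bot \<and> y p = bot then bot
     else if le_above x y p then y p else if le_above y x p then x p else top)"

lemma F_mem: "x \<in> F \<Longrightarrow> p \<in> P \<Longrightarrow> x p \<in> S"
  by (auto simp: F_def)

lemma F_eqI: "x \<in> F \<Longrightarrow> y \<in> F \<Longrightarrow> (\<And>p. p \<in> P \<Longrightarrow> x p = y p) \<Longrightarrow> x = y"
  unfolding F_def by (rule PiE_ext)

lemma F_upd: "x \<in> F \<Longrightarrow> p \<in> P \<Longrightarrow> s \<in> S \<Longrightarrow> x(p := s) \<in> F"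
  by (auto simp: F_def PiE_def extensional_def)

lemma F_restrict: "(\<And>p. p \<in> P \<Longrightarrow> f p \<in> S) \<Longrightarrow> restrict f P \<in> F"
  by (auto simp: F_def)

lemma finite_F: "finite F"
  unfolding F_def using finite_P card_S by (intro finite_PiE) (auto intro: card_ge_0_finite)

lemma agree_self: "agree x y p \<Longrightarrow> p \<in> P \<Longrightarrow> x p = y p"
  by (auto simp: agree_def ord_refl)

lemma agree_mono: "agree x y p \<Longrightarrow> p \<in> P \<Longrightarrow> q \<in> P \<Longrightarrow> p \<preceq> q \<Longrightarrow> agree x y q"
  unfolding agree_def by (meson ord_trans)

lemma agree_refl: "agree x x p"
  by (simp add: agree_def)

lemma agree_sym: "agree x y p \<Longrightarrow> agree y x p"
  by (simp add: agree_def)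

lemma agree_trans: "agree x y p \<Longrightarrow> agree y z p \<Longrightarrow> agree x z p"
  by (simp add: agree_def)

lemma cle_refl: "cle x x"
  by (simp add: cle_def agree_refl)

lemma cle_antisym: "x \<in> F \<Longrightarrow> y \<in> F \<Longrightarrow> cle x y \<Longrightarrow> cle y x \<Longrightarrow> x = y"
proof (rule F_eqI)
  fix p assume "p \<in> P" "cle x y" "cle y x"
  then show "x p = y p"
    using bot_neq_top agree_self[of x y p] agree_self[of y x p] unfolding cle_def by metis
qed

text \<open>Suppose \<open>x p\<close> is not \<open>bot\<close> and \<open>z p\<close> is not
  \<open>top\<close>. Then \<open>y p\<close> is not \<open>top\<close>, as this would force
  \<open>z p = top\<close>. So \<open>x\<close> agrees with \<open>y\<close> from \<open>p\<close>
  upwards, \<open>y p\<close> is not \<open>bot\<close>, and \<open>y\<close> agrees with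
  \<open>z\<close> from \<open>p\<close> upwards.\<close>

lemma cle_trans: "cle x y \<Longrightarrow> cle y z \<Longrightarrow> cle x z"
  unfolding cle_def using bot_neq_top by (metis agree_self agree_trans)

lemma cle_imp_le_above: "cle x y \<Longrightarrow> le_above x y p"
  by (simp add: cle_def le_above_def)

lemma le_above_mono: "le_above x y p \<Longrightarrow> p \<in> P \<Longrightarrow> q \<in> P \<Longrightarrow> p \<preceq> q \<Longrightarrow> le_above x y q"
  unfolding le_above_def by (meson ord_trans)

lemma le_above_cong:
  assumes "agree x x' p" "agree y y' p" "p \<in> P"
  shows "le_above x y p \<longleftrightarrow> le_above x' y' p"
proof -
  have "agree x y q \<longleftrightarrow> agree x' y' q" if "q \<in> P" "p \<preceq> q" for q
    by (meson agree_mono agree_sym agree_trans assms that)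
  then show ?thesis using assms by (auto simp: le_above_def agree_def)
qed

lemma jn_F: "x \<in> F \<Longrightarrow> y \<in> F \<Longrightarrow> jn x y \<in> F"
  unfolding jn_def by (rule F_restrict) (auto simp: F_mem bot_S top_S)

lemma jn_eq_right: "le_above x y p \<Longrightarrow> p \<in> P \<Longrightarrow> agree (jn x y) y p"
  unfolding agree_def jn_def using le_above_mono by auto

text \<open>The formula depends on the order of its arguments only when \<open>le_above\<close>
  holds both ways, and then antisymmetry at \<open>p\<close> makes the two values equal.\<close>

lemma jn_commute: "jn x y = jn y x"
proof
  fix p
  have "x p = y p" if "le_above x y p" "le_above y x p" "p \<in> P"
    using that bot_neq_top unfolding le_above_def by (metis agree_self ord_refl)
  then show "jn x y p = jn y x p" by (auto simp: jn_def)
qed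

lemma jn_eq_left: "le_above y x p \<Longrightarrow> p \<in> P \<Longrightarrow> agree (jn x y) x p"
  by (metis jn_commute jn_eq_right)

text \<open>Locality of the join, the fact that later turns each \<open>agree_off H\<close> into a
  congruence.\<close>

lemma jn_cong:
  assumes "agree x x' p" "agree y y' p" "p \<in> P"
  shows "jn x y p = jn x' y' p"
  using assms le_above_cong[OF assms] le_above_cong[of y y' p x x'] 
  by (auto simp: jn_def dest: agree_self)

lemma jn_left: "cle x (jn x y)"
  unfolding cle_def
proof
  fix p assume p: "p \<in> P"
  consider "x p = bot" | "jn x y p = top" | "x p \<noteq> bot" "jn x y p \<noteq> top" by blast
  then show "x p = bot \<or> jn x y p = top \<or> agree x (jn x y) p"
  proof cases
    case 3
    \<comment> \<open>Neither the first nor the last case of \<open>jn\<close> can apply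
      here.\<close>
    then have "le_above y x p \<or> le_above x y p \<and> y p \<noteq> top"
      using p by (auto simp: jn_def split: if_splits)
    then show ?thesis
    proof
      assume "le_above y x p"
      then show ?thesis using jn_eq_left p agree_sym by blast
    next
      assume *: "le_above x y p \<and> y p \<noteq> top"
      then have "agree x y p" using 3 p ord_refl unfolding le_above_def by blast
      then show ?thesis using * p jn_eq_right agree_trans agree_sym by blast
    qed
  qed auto
qed

lemma jn_right: "cle y (jn x y)"
  by (metis jn_commute jn_left)

text \<open>Where \<open>w\<close> is not \<open>top\<close> and \<open>x\<close> is not
  \<open>bot\<close>, \<open>x\<close> and \<open>w\<close> coincide from \<open>p\<close> upwards.
  Hence \<open>y\<close> lies below \<open>x\<close> there, and the join equals \<open>x\<close> and
  so \<open>w\<close>. Commutativity covers the case that \<open>y\<close> is not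
  \<open>bot\<close>.\<close>

lemma jn_least:
  assumes "cle x w" "cle y w"
  shows "cle (jn x y) w"
  unfolding cle_def
proof
  have *: "agree (jn x y) w p" if "cle x w" "cle y w" "p \<in> P" "w p \<noteq> top" "x p \<noteq> bot" for x y p
  proof -
    have xw: "agree x w p" using that by (auto simp: cle_def)
    then have "le_above y x p" 
      using le_above_cong[of y y p x w] cle_imp_le_above that agree_refl by blast
    then show ?thesis using jn_eq_left xw agree_trans that by blast
  qed
  fix p assume p: "p \<in> P"
  have "jn x y p = bot" if "x p = bot" "y p = bot" using that p by (simp add: jn_def)
  then show "jn x y p = bot \<or> w p = top \<or> agree (jn x y) w p"
    using *[OF assms p] *[OF assms(2,1) p] by (metis jn_commute)
qed

text \<open>With this rule and its dual, concrete joins and meets are computed below from the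
  universal property instead of the formula.\<close>

lemma jn_eqI:
  assumes "x \<in> F" "y \<in> F" "z \<in> F" "cle x z" "cle y z"
    and "\<And>w. w \<in> F \<Longrightarrow> cle x w \<Longrightarrow> cle y w \<Longrightarrow> cle z w"
  shows "jn x y = z"
  using assms jn_F jn_left jn_right jn_least by (meson cle_antisym)

text \<open>The assumptions are symmetric in \<open>bot\<close> and \<open>top\<close>, and swapping
  the two reverses \<open>cle\<close>. Meets are therefore the joins of the swapped instance and
  inherit all their properties.\<close>

lemma dual: "flat_power P ord S top bot"
  by unfold_locales 
    (use finite_P ord_refl ord_antisym ord_trans bot_S top_S bot_neq_top card_S in blast)+

interpretation dual: flat_power P ord S top bot
  by (rule dual)

definition mt :: "('p \<Rightarrow> 's) \<Rightarrow> ('p \<Rightarrow> 's) \<Rightarrow> 'p \<Rightarrow> 's" where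
  "mt = dual.jn"

lemma dual_le: "dual.cle x y \<longleftrightarrow> cle y x"
  by (auto simp: cle_def dual.cle_def dest: agree_sym)

lemmas mt_F = dual.jn_F[folded mt_def]
  and mt_left = dual.jn_left[unfolded dual_le, folded mt_def]
  and mt_right = dual.jn_right[unfolded dual_le, folded mt_def]
  and mt_greatest = dual.jn_least[unfolded dual_le, folded mt_def]
  and mt_eqI = dual.jn_eqI[unfolded dual_le, folded mt_def]
  and mt_cong = dual.jn_cong[folded mt_def]

end

section \<open>Congruences on the functions and the down-sets that determine them\<close>

locale flat_power_congruence = flat_power +
  fixes R :: "('a \<Rightarrow> 'b) \<Rightarrow> ('a \<Rightarrow> 'b) \<Rightarrow> bool"
  assumes R_F: "R x y \<Longrightarrow> x \<in> F \<and> y \<in> F"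
    and R_refl: "x \<in> F \<Longrightarrow> R x x"
    and R_sym: "R x y \<Longrightarrow> R y x"
    and R_trans: "R x y \<Longrightarrow> R y z \<Longrightarrow> R x z"
    and R_jn: "R x y \<Longrightarrow> R u v \<Longrightarrow> R (jn x u) (jn y v)"
    and R_mt: "R x y \<Longrightarrow> R u v \<Longrightarrow> R (mt x u) (mt y v)"
begin

text \<open>This is what five elements of \<open>S\<close> are for: two distinct values remain
  besides \<open>bot\<close>, \<open>top\<close> and one further value \<open>a\<close>.\<close>

lemma two_middle_elements:
  obtains m n where "m \<in> S" "n \<in> S" "m \<noteq> n" "m \<notin> {bot, top, a}" "n \<notin> {bot, top, a}"
proof -
  have "card {bot, top, a} \<le> 3"
    by (simp add: card_insert_if)
  then have "2 \<le> card (S - {bot, top, a})"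
    using diff_card_le_card_Diff[of "{bot, top, a}" S] card_S by simp
  then obtain T where "T \<subseteq> S - {bot, top, a}" "card T = 2"
    by (meson obtain_subset_with_card_n)
  then show ?thesis
    using that by (auto simp: card_2_iff)
qed

text \<open>Meeting \<open>x\<close> and \<open>z\<close> with \<open>y\<close> gives
  \<open>x\<close> and \<open>y\<close>.\<close>

lemma R_convex: "R x z \<Longrightarrow> y \<in> F \<Longrightarrow> cle x y \<Longrightarrow> cle y z \<Longrightarrow> R x y"
proof -
  assume *: "R x z" "y \<in> F" "cle x y" "cle y z"
  then have "R (mt x y) (mt z y)" using R_mt R_refl by blast
  moreover have "mt x y = x" "mt z y = y"
    using * R_F[OF \<open>R x z\<close>] by (auto intro!: mt_eqI cle_refl)
  ultimately show "R x y" by simp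
qed

text \<open>\<open>x'\<close> and \<open>y'\<close> are the meets of \<open>x\<close> and \<open>y\<close>, up to a swap, with \<open>x(q := m)\<close> for a middle element \<open>m\<close>.\<close>

lemma separate_from_bot:
  assumes "R x y" "q \<in> P" "x q \<noteq> y q"
    and above: "\<And>r. r \<in> P \<Longrightarrow> q \<preceq> r \<Longrightarrow> r \<noteq> q \<Longrightarrow> x r = y r"
  obtains x' y' where "R x' y'" "x' q = bot" "y' q \<noteq> bot"
proof -
  \<comment> \<open>The two inequalities with \<open>bot\<close> and \<open>top\<close> are a
    normalisation: if they fail for a pair with \<open>x q \<noteq> y q\<close>, they hold for the
    swapped pair.\<close>
  have *: "\<exists>x' y'. R x' y' \<and> x' q = bot \<and> y' q \<noteq> bot"
    if xy: "R x y" "x q \<noteq> y q" "y q \<noteq> bot" "x q \<noteq> top"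
      and ab: "\<And>r. r \<in> P \<Longrightarrow> q \<preceq> r \<Longrightarrow> r \<noteq> q \<Longrightarrow> x r = y r" for x y
  proof -
    have F: "x \<in> F" "y \<in> F" using R_F xy(1) by auto
    \<comment> \<open>If \<open>y q\<close> is itself a middle value, it serves as \<open>m\<close>;
      if it is \<open>top\<close>, any middle value other than \<open>x q\<close> does.\<close>
    obtain m where m: "m \<in> S" "m \<notin> {bot, top, x q}" "m = y q \<or> y q = top"
      using two_middle_elements[of "x q"] xy F_mem[OF F(2) \<open>q \<in> P\<close>] 
      by (metis empty_iff insert_iff)
    define v where "v = x(q := m)"
    \<comment> \<open>A common lower bound of \<open>y\<close> and \<open>v\<close> with value
      \<open>m\<close> at \<open>q\<close>; it keeps their meet away from \<open>bot\<close>
      there.\<close>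
    define u where "u = (\<lambda>p\<in>P. if q \<preceq> p then v p else bot)"
    have v: "v \<in> F" using F m \<open>q \<in> P\<close> by (simp add: v_def F_upd)
    have "R (mt x v) (mt y v)" using xy v R_mt R_refl by blast
    \<comment> \<open>A value other than \<open>bot\<close> would have to equal both
      \<open>x q\<close> and \<open>m\<close>, since neither of these is \<open>top\<close>.\<close>
    moreover have "mt x v q = bot"
      using mt_left[of x v] mt_right[of x v] \<open>q \<in> P\<close> m xy agree_self[of _ _ q]
      unfolding cle_def v_def by (metis fun_upd_same insert_iff)
    moreover have "mt y v q \<noteq> bot"
    proof -
      have uv: "u p = v p" if "p \<in> P" "q \<preceq> p" for p using that by (simp add: u_def)
      have u_bot: "u p = bot" if "p \<in> P" "\<not> q \<preceq> p" for p using that by (simp add: u_def)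
      have vy: "v p = y p" if "p \<in> P" "q \<preceq> p" "p \<noteq> q" for p using that ab by (simp add: v_def)
      have agr: "agree u v p" if "p \<in> P" "q \<preceq> p" for p
        using that ord_trans uv \<open>q \<in> P\<close> unfolding agree_def by blast
      have "cle u v" unfolding cle_def using agr u_bot by blast
      moreover have "cle u y" 
        unfolding cle_def
      proof
        fix p assume p: "p \<in> P"
        show "u p = bot \<or> y p = top \<or> agree u y p"
        proof (cases "q \<preceq> p \<and> (p = q \<longrightarrow> y q \<noteq> top)")
          case True
          have "v r = y r" if "r \<in> P" "p \<preceq> r" for r
          proof (cases "r = q")
            case True
            then have "p = q" using that \<open>q \<preceq> p \<and> _\<close> ord_antisym p by blast
            then show ?thesis using True m \<open>q \<preceq> p \<and> _\<close> by (auto simp: v_def)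
          next
            case False
            then show ?thesis using vy that True p \<open>q \<in> P\<close> ord_trans by blast
          qed
          then have "agree v y p" by (simp add: agree_def)
          then show ?thesis using agr p True agree_trans by blast
        qed (use u_bot p in auto)
      qed
      ultimately have "cle u (mt y v)" using mt_greatest by blast
      moreover have "u q \<noteq> bot" using uv \<open>q \<in> P\<close> ord_refl m by (auto simp: v_def)
      ultimately show ?thesis
        using \<open>q \<in> P\<close> bot_neq_top agree_self[of u _ q] unfolding cle_def by metis
    qed
    ultimately show ?thesis by blast
  qed
  have "\<exists>x' y'. R x' y' \<and> x' q = bot \<and> y' q \<noteq> bot"
  proof (cases "y q \<noteq> bot \<and> x q \<noteq> top")
    case True
    then show ?thesis using *[of x y] assms by blast
  next
    case False
    then have "x q \<noteq> bot" "y q \<noteq> top" using assms(3) bot_neq_top by metis+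
    then show ?thesis using *[of y x] assms R_sym by metis
  qed
  then show ?thesis using that by blast
qed

text \<open>The relation is passed along a chain of pairs: \<open>T(q := m)\<close> and
  \<open>T\<close>, then \<open>T(q := bot)\<close> and \<open>T\<close>, then \<open>lo\<close> and
  \<open>M m\<close>, then \<open>lo\<close> and \<open>hi\<close>. The last two are the least and
  the greatest function that agree with \<open>w\<close> off the down-set of \<open>q\<close>, so
  convexity reaches every function in between.\<close>

lemma collapse_below:
  assumes "R x y" "q \<in> P" "x q \<noteq> y q"
    and above: "\<And>r. r \<in> P \<Longrightarrow> q \<preceq> r \<Longrightarrow> r \<noteq> q \<Longrightarrow> x r = y r"
    and w: "w \<in> F" "w' \<in> F" "\<And>p. p \<in> P \<Longrightarrow> \<not> p \<preceq> q \<Longrightarrow> w p = w' p"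
  shows "R w w'"
proof -
  obtain x y where xy: "R x y" "x q = bot" "y q \<noteq> bot"
    using separate_from_bot[OF assms(1-4)] by blast
  have F: "x \<in> F" "y \<in> F" using R_F xy(1) by auto
  \<comment> \<open>Joining with \<open>T(q := m)\<close> erases every coordinate of \<open>x\<close> and \<open>y\<close> except whether it is \<open>bot\<close> at \<open>q\<close>.\<close>
  define T where "T = (\<lambda>p\<in>P. top)"
  have T: "T \<in> F" using top_S by (auto simp: T_def intro: F_restrict)
  have Tq: "T(q := a) \<in> F" if "a \<in> S" for a using that T F_upd \<open>q \<in> P\<close> by blast
  have T_top: "T p = top" if "p \<in> P" for p using that by (simp add: T_def)
  have T_mid: "R (T(q := m)) T" if m: "m \<in> S" "m \<notin> {bot, top, y q}" for m
  proof -
    have "jn x (T(q := m)) = T(q := m)"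
      using xy T_top F Tq m \<open>q \<in> P\<close> by (intro jn_eqI) (auto simp: cle_def agree_refl)
    \<comment> \<open>An upper bound that is not \<open>top\<close> at \<open>q\<close> would have
      to take both values \<open>y q\<close> and \<open>m\<close> there.\<close>
    moreover have "jn y (T(q := m)) = T"
    proof (rule jn_eqI)
      show "cle T z" if "cle y z" "cle (T(q := m)) z" for z
        unfolding cle_def
      proof
        fix p assume p: "p \<in> P"
        have "z p = top"
          using that[unfolded cle_def, rule_format, OF p] p T_top[OF p] m xy bot_neq_top
            agree_self[of y z p] agree_self[of "T(q := m)" z p]
          by (cases "p = q") auto
        then show "T p = bot \<or> z p = top \<or> agree T z p" by simp
      qed
    qed (use xy T_top F Tq T m in \<open>auto simp: cle_def\<close>)
    moreover have "R (jn x (T(q := m))) (jn y (T(q := m)))"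
      using R_jn xy(1) R_refl Tq m by blast
    ultimately show ?thesis by simp
  qed
  have T_bot: "R (T(q := bot)) T"
  proof -
    obtain m n where mn: "m \<in> S" "n \<in> S" "m \<noteq> n" "m \<notin> {bot, top, y q}" "n \<notin> {bot, top, y q}"
      by (rule two_middle_elements)
    \<comment> \<open>As in \<open>M3\<close>, two different middle values at \<open>q\<close> meet
      in \<open>bot\<close>.\<close>
    have "mt (T(q := m)) (T(q := n)) = T(q := bot)"
    proof (rule mt_eqI)
      show "cle z (T(q := bot))" if "cle z (T(q := m))" "cle z (T(q := n))" for z
        unfolding cle_def
      proof
        fix p assume p: "p \<in> P"
        show "z p = bot \<or> (T(q := bot)) p = top \<or> agree z (T(q := bot)) p"
          using that[unfolded cle_def, rule_format, OF p] p T_top[OF p] mn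
            agree_self[of z "T(q := m)" p] agree_self[of z "T(q := n)" p]
          by (cases "p = q") auto
      qed
    qed (use T_top Tq bot_S mn in \<open>auto simp: cle_def\<close>)
    moreover have "mt T T = T" using T by (intro mt_eqI cle_refl)
    moreover have "R (mt (T(q := m)) (T(q := n))) (mt T T)"
      using R_mt T_mid mn by blast
    ultimately show ?thesis by simp
  qed
  \<comment> \<open>Below \<open>q\<close> the meet of \<open>T(q := bot)\<close> with \<open>M m\<close> drops to \<open>bot\<close>, since the two disagree at \<open>q\<close>;
    this is how a change at \<open>q\<close> spreads to the smaller indices.\<close>
  define lo where "lo = (\<lambda>p\<in>P. if p \<preceq> q then bot else w p)"
  define hi where "hi = (\<lambda>p\<in>P. if p \<preceq> q then top else w p)"
  have lo_bot: "lo p = bot" and hi_top: "hi p = top" if "p \<in> P" "p \<preceq> q" for p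
    using that by (simp_all add: lo_def hi_def)
  \<comment> \<open>The value \<open>top\<close> at \<open>q\<close> differs from the
    \<open>bot\<close> forced on lower bounds of \<open>T(q := bot)\<close>, and it is already the
    value of \<open>hi\<close>. Joining \<open>M m\<close> and \<open>M n\<close> for
    \<open>m \<noteq> n\<close> thus has to raise only the indices strictly below
    \<open>q\<close>.\<close>
  define M where "M m = (\<lambda>p\<in>P. if p = q then top else if p \<preceq> q then m else w p)" for m
  have lo: "lo \<in> F" and hi: "hi \<in> F" and M: "M m \<in> F" if "m \<in> S" for m
    using that w bot_S top_S unfolding lo_def hi_def M_def by (auto intro!: F_restrict simp: F_mem)
  have off: "agree lo (M m) p \<and> agree hi (M m) p" if "p \<in> P" "\<not> p \<preceq> q" for p m
  proof -
    have "\<not> r \<preceq> q" if "r \<in> P" "p \<preceq> r" for r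
      using that \<open>p \<in> P\<close> \<open>\<not> p \<preceq> q\<close> \<open>q \<in> P\<close> ord_trans by blast
    then show ?thesis using \<open>q \<in> P\<close> ord_refl by (auto simp: agree_def lo_def hi_def M_def)
  qed
  have lo_M: "R lo (M m)" if m: "m \<in> S" "m \<notin> {bot, top}" for m
  proof -
    have "mt (T(q := bot)) (M m) = lo"
    proof (rule mt_eqI)
      show "cle lo (T(q := bot))"
        using T_top ord_refl \<open>q \<in> P\<close> by (auto simp: cle_def lo_def)
      show "cle lo (M m)"
        using off lo_bot unfolding cle_def by blast
      show "cle z lo" if "cle z (T(q := bot))" "cle z (M m)" for z
        unfolding cle_def
      proof
        fix p assume p: "p \<in> P"
        have zq: "z q = bot"
          using that(1) \<open>q \<in> P\<close> bot_neq_top agree_self[of z _ q] unfolding cle_def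
          by (metis fun_upd_same)
        have M': "z p = bot \<or> M m p = top \<or> agree z (M m) p" using that(2) p by (simp add: cle_def)
        show "z p = bot \<or> lo p = top \<or> agree z lo p"
        proof (cases "p \<preceq> q")
          case False
          have "lo p = M m p" using off[OF p False] agree_self p by blast
          then show ?thesis using M' off[OF p False] agree_trans agree_sym by metis
        next
          case True
          have "\<not> agree z (M m) p"
            using zq True \<open>q \<in> P\<close> bot_neq_top by (auto simp: agree_def M_def)
          then show ?thesis using M' zq True m p by (auto simp: M_def split: if_splits)
        qed
      qed
    qed (use lo M Tq bot_S m in auto)
    moreover have "mt T (M m) = M m"
      using T M m T_top by (intro mt_eqI) (auto simp: cle_def agree_refl)
    moreover have "R (mt (T(q := bot)) (M m)) (mt T (M m))"
      using R_mt T_bot R_refl M m by blast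
    ultimately show ?thesis by simp
  qed
  have lo_hi: "R lo hi"
  proof -
    \<comment> \<open>The repeated \<open>bot\<close> comes from instantiating the parameter
      \<open>a\<close> with an element that is excluded anyway.\<close>
    obtain m n where mn: "m \<in> S" "n \<in> S" "m \<noteq> n" "m \<notin> {bot, top, bot}" "n \<notin> {bot, top, bot}"
      by (rule two_middle_elements)
    have M_hi: "cle (M k) hi" for k
      using off agree_sym hi_top unfolding cle_def by blast
    have "jn (M m) (M n) = hi"
    proof (rule jn_eqI)
      show "cle hi z" if "cle (M m) z" "cle (M n) z" for z
        unfolding cle_def
      proof
        fix p assume p: "p \<in> P"
        note * = that[unfolded cle_def, rule_format, OF p]
        show "hi p = bot \<or> z p = top \<or> agree hi z p"
        proof (cases "p \<preceq> q")
          case False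
          have "hi p = M m p" using off[OF p False] agree_self p by blast
          then show ?thesis using * off[OF p False] agree_trans agree_sym by metis
        next
          case True
          have "z p = top"
            using * agree_self[of "M m" z p] agree_self[of "M n" z p] mn p True bot_neq_top
            by (auto simp: M_def split: if_splits)
          then show ?thesis by simp
        qed
      qed
    qed (use hi M mn M_hi in auto)
    moreover have "jn lo lo = lo" using lo mn by (intro jn_eqI cle_refl)
    moreover have "R (jn lo lo) (jn (M m) (M n))" using R_jn lo_M mn by blast
    ultimately show ?thesis by simp
  qed
  have "R lo v" if "v \<in> F" "\<And>p. p \<in> P \<Longrightarrow> \<not> p \<preceq> q \<Longrightarrow> w p = v p" for v
  proof (rule R_convex[OF lo_hi that(1)])
    have "agree lo v p \<and> agree hi v p" if "p \<in> P" "\<not> p \<preceq> q" for p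
    proof -
      have "\<not> r \<preceq> q" if "r \<in> P" "p \<preceq> r" for r
        using that \<open>p \<in> P\<close> \<open>\<not> p \<preceq> q\<close> \<open>q \<in> P\<close> ord_trans by blast
      then show ?thesis
        using \<open>\<And>p. p \<in> P \<Longrightarrow> \<not> p \<preceq> q \<Longrightarrow> w p = v p\<close> by (auto simp: agree_def lo_def hi_def)
    qed
    then show "cle lo v" "cle v hi"
      using lo_bot hi_top agree_sym unfolding cle_def by blast+
  qed
  then have "R lo w" "R lo w'" using w by blast+
  then show ?thesis using R_sym R_trans by blast
qed

text \<open>This is the down-set \<open>H\<close> for which \<open>R\<close> will turn out to be
  agreement off \<open>H\<close>.\<close>

definition moved :: "'a set" where
  "moved = {p \<in> P. \<exists>x y. R x y \<and> x p \<noteq> y p}"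

text \<open>Take a related pair that differs at \<open>p\<close>, and let \<open>q\<close> be
  maximal among the indices above \<open>p\<close> where it differs. The pair then agrees strictly
  above \<open>q\<close>, and \<open>collapse_below\<close> applies.\<close>

lemma moved_collapse:
  assumes "p \<in> moved"
  obtains q where "q \<in> P" "p \<preceq> q"
    "\<And>w w'. w \<in> F \<Longrightarrow> w' \<in> F \<Longrightarrow> (\<And>r. r \<in> P \<Longrightarrow> \<not> r \<preceq> q \<Longrightarrow> w r = w' r) \<Longrightarrow> R w w'"
proof -
  obtain x y where xy: "p \<in> P" "R x y" "x p \<noteq> y p" using assms by (auto simp: moved_def)
  define Q where "Q = {q \<in> P. p \<preceq> q \<and> x q \<noteq> y q}"
  have "\<exists>q\<in>Q. \<forall>r\<in>Q. r \<noteq> q \<longrightarrow> \<not> (q \<preceq> r \<and> q \<noteq> r)"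
  proof (rule Finite_Set.bex_max_element)
    show "finite Q" using finite_P by (simp add: Q_def)
    show "Q \<noteq> {}" using xy ord_refl by (auto simp: Q_def)
    show "asymp_on Q (\<lambda>q r. q \<preceq> r \<and> q \<noteq> r)"
      by (rule asymp_onI) (use ord_antisym in \<open>auto simp: Q_def\<close>)
    show "transp_on Q (\<lambda>q r. q \<preceq> r \<and> q \<noteq> r)"
      by (rule transp_onI) (use ord_antisym ord_trans in \<open>unfold Q_def, blast\<close>)
  qed
  then obtain q where q: "q \<in> Q" "\<And>r. r \<in> Q \<Longrightarrow> q \<preceq> r \<Longrightarrow> r = q" by metis
  then have qP: "q \<in> P" "p \<preceq> q" "x q \<noteq> y q" by (auto simp: Q_def)
  have "x r = y r" if "r \<in> P" "q \<preceq> r" "r \<noteq> q" for r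
    using q(2)[of r] that qP xy(1) ord_trans unfolding Q_def by blast
  then show ?thesis
    using that[OF qP(1,2)] collapse_below[OF xy(2) qP(1,3)] by blast
qed

text \<open>For \<open>r\<close> below \<open>p\<close> and hence below the collapsing index
  \<open>q\<close>, the constant function \<open>bot\<close> is related to its modification at
  \<open>r\<close>.\<close>

lemma moved_downset:
  assumes "p \<in> moved" "r \<in> P" "r \<preceq> p"
  shows "r \<in> moved"
proof -
  have "p \<in> P" using assms by (simp add: moved_def)
  obtain q where q: "q \<in> P" "p \<preceq> q" 
    "\<And>w w'. w \<in> F \<Longrightarrow> w' \<in> F \<Longrightarrow> (\<And>r. r \<in> P \<Longrightarrow> \<not> r \<preceq> q \<Longrightarrow> w r = w' r) \<Longrightarrow> R w w'"
    using moved_collapse[OF assms(1)] by metis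
  have "r \<preceq> q" using ord_trans assms q \<open>p \<in> P\<close> by blast
  define B where "B = (\<lambda>p\<in>P. bot)"
  have B: "B \<in> F" using bot_S by (auto simp: B_def intro: F_restrict)
  have "R B (B(r := top))"
    using \<open>r \<preceq> q\<close> by (intro q(3) B F_upd assms top_S) auto
  moreover have "B r \<noteq> (B(r := top)) r" using assms bot_neq_top by (simp add: B_def)
  ultimately show ?thesis using assms unfolding moved_def by blast
qed

text \<open>For the converse, the coordinates of \<open>x\<close> in \<open>moved\<close> are
  replaced by those of \<open>y\<close> one at a time. Each replacement at \<open>k\<close> stays
  within one class because \<open>k\<close> lies below a collapsing index.\<close>

lemma R_iff:
  assumes x: "x \<in> F" and y: "y \<in> F"
  shows "R x y \<longleftrightarrow> (\<forall>p\<in>P - moved. x p = y p)"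
proof
  show "R x y \<Longrightarrow> \<forall>p\<in>P - moved. x p = y p" by (auto simp: moved_def)
  have "finite moved" using finite_P by (simp add: moved_def)
  have "R x y" if "x \<in> F" "\<forall>p\<in>P - K. x p = y p" "K \<subseteq> moved" "finite K" for K
    using that(4,1-3)
  proof (induction K arbitrary: x)
    case empty
    then show ?case using F_eqI[of x y] y R_refl by auto
  next
    case (insert k K)
    have k: "k \<in> P" "k \<in> moved" using insert.prems by (auto simp: moved_def)
    obtain q where q: "q \<in> P" "k \<preceq> q" 
      "\<And>w w'. w \<in> F \<Longrightarrow> w' \<in> F \<Longrightarrow> (\<And>r. r \<in> P \<Longrightarrow> \<not> r \<preceq> q \<Longrightarrow> w r = w' r) \<Longrightarrow> R w w'"
      using moved_collapse[OF k(2)] by metis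
    let ?x = "x(k := y k)"
    have x': "?x \<in> F" using F_upd insert.prems y k F_mem by blast
    have "R x ?x" using q(2) by (intro q(3) insert.prems x') auto
    moreover have "R ?x y" by (rule insert.IH[OF x']) (use insert.prems in auto)
    ultimately show ?case using R_trans by blast
  qed
  from this[of moved] \<open>finite moved\<close> x
  show "\<forall>p\<in>P - moved. x p = y p \<Longrightarrow> R x y" by blast
qed

end

section \<open>Order isomorphisms between lattices\<close>

text \<open>By surjectivity the join of the images is itself an image \<open>f w\<close>, and
  comparing \<open>w\<close> with the join in \<open>A\<close> settles the matter; meets are alike.
  Later isomorphisms are checked on the order only.\<close>

lemma order_iso_imp_lattice_isomorphic:
  assumes A: "lattice A" and B: "lattice B"
    and f: "bij_betw f (carrier A) (carrier B)"
    and ord: "\<And>x y. x \<in> carrier A \<Longrightarrow> y \<in> carrier A \<Longrightarrow> x \<sqsubseteq>\<^bsub>A\<^esub> y \<longleftrightarrow> f x \<sqsubseteq>\<^bsub>B\<^esub> f y"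
  shows "lattice_isomorphic A B"
proof -
  interpret A: lattice A by fact
  interpret B: lattice B by fact
  have fc: "f x \<in> carrier B" if "x \<in> carrier A" for x
    using that f bij_betwE by blast
  have fs: "\<exists>w\<in>carrier A. f w = z" if "z \<in> carrier B" for z
    using that f by (metis bij_betw_def imageE)
  have "f (x \<squnion>\<^bsub>A\<^esub> y) = f x \<squnion>\<^bsub>B\<^esub> f y" if xy: "x \<in> carrier A" "y \<in> carrier A" for x y
  proof -
    obtain w where w: "w \<in> carrier A" "f w = f x \<squnion>\<^bsub>B\<^esub> f y"
      using fs fc xy B.join_closed by metis
    have "x \<squnion>\<^bsub>A\<^esub> y \<sqsubseteq>\<^bsub>A\<^esub> w"
      using w xy ord fc B.join_left B.join_right by (intro A.join_le) auto
    then have "f (x \<squnion>\<^bsub>A\<^esub> y) \<sqsubseteq>\<^bsub>B\<^esub> f x \<squnion>\<^bsub>B\<^esub> f y" using w xy ord by force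
    moreover have "f x \<squnion>\<^bsub>B\<^esub> f y \<sqsubseteq>\<^bsub>B\<^esub> f (x \<squnion>\<^bsub>A\<^esub> y)"
      using ord xy A.join_left A.join_right by (intro B.join_le) (auto simp: fc)
    ultimately show ?thesis using fc xy by (intro B.le_antisym) auto
  qed
  moreover have "f (x \<sqinter>\<^bsub>A\<^esub> y) = f x \<sqinter>\<^bsub>B\<^esub> f y" if xy: "x \<in> carrier A" "y \<in> carrier A" for x y
  proof -
    obtain w where w: "w \<in> carrier A" "f w = f x \<sqinter>\<^bsub>B\<^esub> f y"
      using fs fc xy B.meet_closed by metis
    have "w \<sqsubseteq>\<^bsub>A\<^esub> x \<sqinter>\<^bsub>A\<^esub> y"
      using w xy ord fc B.meet_left B.meet_right by (intro A.meet_le) auto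
    then have "f x \<sqinter>\<^bsub>B\<^esub> f y \<sqsubseteq>\<^bsub>B\<^esub> f (x \<sqinter>\<^bsub>A\<^esub> y)" using w xy ord by force
    moreover have "f (x \<sqinter>\<^bsub>A\<^esub> y) \<sqsubseteq>\<^bsub>B\<^esub> f x \<sqinter>\<^bsub>B\<^esub> f y"
      using ord xy A.meet_left A.meet_right by (intro B.meet_le) (auto simp: fc)
    ultimately show ?thesis using fc xy by (intro B.le_antisym) auto
  qed
  ultimately have "f \<in> lattice_iso A B"
    using A B f by (simp add: lattice_iso_def join_pres_def meet_pres_def)
  then show ?thesis by (auto simp: lattice_isomorphic_def)
qed

section \<open>The lattice on an arbitrary carrier\<close>

locale flat_power_lattice = flat_power P ord S bot top
  for P :: "'p set" and ord :: "'p \<Rightarrow> 'p \<Rightarrow> bool" (infix \<open>\<preceq>\<close> 50)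
    and S :: "'s set" and bot top :: 's +
  fixes C :: "'c set" and d :: "'c \<Rightarrow> 'p \<Rightarrow> 's"
  assumes bij_d: "bij_betw d C F"
begin

text \<open>The order is pulled back along the bijection \<open>d\<close>, so that the carrier can
  later be a set of natural numbers.\<close>

definition L :: "'c gorder" where
  "L = \<lparr>carrier = C, eq = (=), le = (\<lambda>x y. cle (d x) (d y))\<rparr>"

lemma L_simps [simp]:
  "carrier L = C" "x .=\<^bsub>L\<^esub> y \<longleftrightarrow> x = y" "x \<sqsubseteq>\<^bsub>L\<^esub> y \<longleftrightarrow> cle (d x) (d y)"
  by (simp_all add: L_def)

lemma d_F: "x \<in> C \<Longrightarrow> d x \<in> F"
  using bij_d bij_betwE by blast

lemma d_eqD: "x \<in> C \<Longrightarrow> y \<in> C \<Longrightarrow> d x = d y \<Longrightarrow> x = y"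
  using bij_d by (auto simp: bij_betw_def dest: inj_onD)

lemma d_surj: "w \<in> F \<Longrightarrow> \<exists>x\<in>C. d x = w"
  using bij_d by (metis bij_betw_def imageE)

lemma is_lub_jn: "x \<in> C \<Longrightarrow> y \<in> C \<Longrightarrow> z \<in> C \<Longrightarrow> d z = jn (d x) (d y) \<Longrightarrow> is_lub L z {x, y}"
  by (auto simp: least_def Upper_def jn_left jn_right jn_least)

lemma is_glb_mt: "x \<in> C \<Longrightarrow> y \<in> C \<Longrightarrow> z \<in> C \<Longrightarrow> d z = mt (d x) (d y) \<Longrightarrow> is_glb L z {x, y}"
  by (auto simp: greatest_def Lower_def mt_left mt_right mt_greatest)

lemma lattice_L: "lattice L"
proof -
  interpret partial_order L
    by unfold_locales 
      (auto simp: fun_eq_iff cle_refl intro: cle_trans, meson d_F d_eqD cle_antisym)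
  show ?thesis
  proof
    fix x y assume "x \<in> carrier L" "y \<in> carrier L"
    then show "\<exists>s. is_lub L s {x, y}" "\<exists>s. is_glb L s {x, y}"
      using is_lub_jn is_glb_mt d_surj jn_F mt_F d_F by (metis L_simps(1))+
  qed
qed

interpretation L: lattice L
  by (rule lattice_L)

lemma d_join: "x \<in> C \<Longrightarrow> y \<in> C \<Longrightarrow> d (x \<squnion>\<^bsub>L\<^esub> y) = jn (d x) (d y)"
  using L.sup_of_two_least[of x y] is_lub_jn[of x y] d_surj[of "jn (d x) (d y)"] d_F jn_F
    L.least_unique unfolding join_def by (metis L_simps(1))

lemma d_meet: "x \<in> C \<Longrightarrow> y \<in> C \<Longrightarrow> d (x \<sqinter>\<^bsub>L\<^esub> y) = mt (d x) (d y)"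
  using L.inf_of_two_greatest[of x y] is_glb_mt[of x y] d_surj[of "mt (d x) (d y)"] d_F mt_F
    L.greatest_unique unfolding meet_def by (metis L_simps(1))

section \<open>Congruences of the lattice as down-sets, and their classes\<close>

definition down_closed :: "'p set \<Rightarrow> bool" where
  "down_closed H \<longleftrightarrow> H \<subseteq> P \<and> (\<forall>p\<in>H. \<forall>q\<in>P. q \<preceq> p \<longrightarrow> q \<in> H)"

definition agree_off :: "'p set \<Rightarrow> ('c \<times> 'c) set" where
  "agree_off H = {(x, y) \<in> C \<times> C. \<forall>p\<in>P - H. d x p = d y p}"

text \<open>If \<open>p\<close> is outside the down-set \<open>H\<close>, so is its whole up-set.
  Related elements therefore agree from \<open>p\<close> upwards, and locality of joins and meets
  applies.\<close>

lemma agree_off_congruence: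
  assumes H: "down_closed H"
  shows "lattice_congruence L (agree_off H)"
  unfolding lattice_congruence_def
proof (intro conjI allI impI)
  show "equiv (carrier L) (agree_off H)"
    by (rule equivI) (auto simp: agree_off_def refl_on_def sym_def trans_def)
  fix a b u v assume *: "(a, b) \<in> agree_off H" "(u, v) \<in> agree_off H"
  then have C: "a \<in> C" "b \<in> C" "u \<in> C" "v \<in> C" by (auto simp: agree_off_def)
  have "agree (d a) (d b) p \<and> agree (d u) (d v) p" if "p \<in> P - H" for p
    using * that H unfolding agree_off_def agree_def down_closed_def by blast
  then show "(a \<squnion>\<^bsub>L\<^esub> u, b \<squnion>\<^bsub>L\<^esub> v) \<in> agree_off H" "(a \<sqinter>\<^bsub>L\<^esub> u, b \<sqinter>\<^bsub>L\<^esub> v) \<in> agree_off H"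
    using C L.join_closed L.meet_closed by (auto simp: agree_off_def d_join d_meet intro: jn_cong mt_cong)
qed

text \<open>The image of \<open>\<Theta>\<close> under \<open>d\<close> satisfies the axioms of
  \<open>flat_power_congruence\<close>, transitivity by injectivity of \<open>d\<close>. Its set
  \<open>moved\<close> is the required \<open>H\<close>.\<close>

lemma congruence_is_agree_off:
  assumes "lattice_congruence L \<Theta>"
  shows "\<exists>H. down_closed H \<and> \<Theta> = agree_off H"
proof -
  have eqv: "equiv C \<Theta>" using assms by (simp add: lattice_congruence_def)
  define R where "R x y \<longleftrightarrow> (\<exists>u v. (u, v) \<in> \<Theta> \<and> d u = x \<and> d v = y)" for x y
  have \<Theta>_C: "u \<in> C \<and> v \<in> C" if "(u, v) \<in> \<Theta>" for u v
    using equiv_type[OF eqv] that by blast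
  interpret R: flat_power_congruence P ord S bot top R
  proof
    fix x y z u v
    show "R x y \<Longrightarrow> x \<in> F \<and> y \<in> F" using \<Theta>_C d_F by (auto simp: R_def)
    show "x \<in> F \<Longrightarrow> R x x" using d_surj eqv unfolding R_def equiv_def refl_on_def by metis
    show "R x y \<Longrightarrow> R y x" using eqv unfolding R_def equiv_def sym_def by blast
    show "R x z" if xyz: "R x y" "R y z"
    proof -
      obtain a b b' c where "(a, b) \<in> \<Theta>" "(b', c) \<in> \<Theta>" "d a = x" "d b = y" "d b' = y" "d c = z"
        using xyz by (auto simp: R_def)
      moreover from this have "b = b'" using d_eqD \<Theta>_C by metis
      ultimately show ?thesis using eqv unfolding R_def equiv_def trans_def by blast
    qed
    show "R (jn x u) (jn y v)" "R (mt x u) (mt y v)" if R: "R x y" "R u v"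
    proof -
      obtain a b a' b' where *: "(a, b) \<in> \<Theta>" "(a', b') \<in> \<Theta>" "d a = x" "d b = y" "d a' = u" "d b' = v"
        using R unfolding R_def by blast
      then have "(a \<squnion>\<^bsub>L\<^esub> a', b \<squnion>\<^bsub>L\<^esub> b') \<in> \<Theta>" "(a \<sqinter>\<^bsub>L\<^esub> a', b \<sqinter>\<^bsub>L\<^esub> b') \<in> \<Theta>"
        using assms by (auto simp: lattice_congruence_def)
      then show "R (jn x u) (jn y v)" "R (mt x u) (mt y v)"
        unfolding R_def using * \<Theta>_C d_join d_meet by metis+
    qed
  qed
  have "(x, y) \<in> \<Theta> \<longleftrightarrow> R (d x) (d y)" if "x \<in> C" "y \<in> C" for x y
    unfolding R_def using that \<Theta>_C d_eqD by metis
  then have "(x, y) \<in> \<Theta> \<longleftrightarrow> (x, y) \<in> agree_off R.moved" for x y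
    using R.R_iff d_F \<Theta>_C unfolding agree_off_def by blast
  then have "\<Theta> = agree_off R.moved" by auto
  moreover have "down_closed R.moved"
    unfolding down_closed_def using R.moved_downset by (auto simp: R.moved_def)
  ultimately show ?thesis by blast
qed

text \<open>An index \<open>p\<close> of \<open>H\<close> is detected by the constant function
  \<open>bot\<close> and its modification at \<open>p\<close>, which are related under
  \<open>agree_off H\<close>.\<close>

lemma agree_off_subset_iff:
  assumes "H \<subseteq> P"
  shows "agree_off H \<subseteq> agree_off K \<longleftrightarrow> H \<subseteq> K"
proof
  assume sub: "agree_off H \<subseteq> agree_off K"
  show "H \<subseteq> K"
  proof
    fix p assume p: "p \<in> H"
    define B where "B = (\<lambda>p\<in>P. bot)"
    have B: "B \<in> F" using bot_S by (auto simp: B_def intro: F_restrict)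
    obtain x y where xy: "x \<in> C" "y \<in> C" "d x = B" "d y = B(p := top)"
      using d_surj[OF B] d_surj[OF F_upd[OF B _ top_S, of p]] p assms by blast
    then have "(x, y) \<in> agree_off H" using p by (auto simp: agree_off_def)
    then have "(x, y) \<in> agree_off K" using sub by blast
    moreover have "d x p \<noteq> d y p" using xy p assms bot_neq_top by (auto simp: B_def)
    ultimately show "p \<in> K" using p assms by (auto simp: agree_off_def)
  qed
qed (auto simp: agree_off_def)

text \<open>Overwriting the coordinates outside \<open>H\<close> moves one class of \<^term>\<open>agree_off H\<close> onto another.\<close>

lemma isoform_agree_off:
  assumes H: "down_closed H"
  shows "isoform_congruence L (agree_off H)"
  unfolding isoform_congruence_def
proof (intro ballI)
  fix X Y assume X: "X \<in> carrier L // agree_off H" and Y: "Y \<in> carrier L // agree_off H"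
  have class_eq: "\<exists>c\<in>C. X = {x \<in> C. \<forall>p\<in>P - H. d x p = d c p}" 
    if X: "X \<in> carrier L // agree_off H" for X
  proof -
    obtain c where "c \<in> C" "X = agree_off H `` {c}" using X by (auto elim: quotientE)
    then show ?thesis by (intro bexI[of _ c]) (auto simp: agree_off_def)
  qed
  obtain a where a: "a \<in> C" "X = {x \<in> C. \<forall>p\<in>P - H. d x p = d a p}" using class_eq[OF X] by blast
  obtain b where b: "b \<in> C" "Y = {x \<in> C. \<forall>p\<in>P - H. d x p = d b p}" using class_eq[OF Y] by blast
  define g where "g c x = inv_into C d (\<lambda>p\<in>P. if p \<in> H then d x p else d c p)" for c x
  have d_g: "d (g c x) = (\<lambda>p\<in>P. if p \<in> H then d x p else d c p) \<and> g c x \<in> C"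
    if "c \<in> C" "x \<in> C" for c x
  proof -
    have "(\<lambda>p\<in>P. if p \<in> H then d x p else d c p) \<in> F"
      by (rule F_restrict) (use that d_F F_mem in auto)
    then have "(\<lambda>p\<in>P. if p \<in> H then d x p else d c p) \<in> d ` C"
      using bij_d by (simp add: bij_betw_def)
    then show ?thesis unfolding g_def by (simp add: f_inv_into_f inv_into_into)
  qed
  \<comment> \<open>Stated for arbitrary \<open>a\<close> and \<open>b\<close>, since
    \<open>g a\<close> and \<open>g b\<close> must be inverse in both orders.\<close>
  have g_g: "g a (g b x) = x" if "a \<in> C" "b \<in> C" "x \<in> C" "\<forall>p\<in>P - H. d x p = d a p" for a b x
    by (rule d_eqD, simp_all add: d_g that, rule F_eqI[OF _ d_F])
      (use that d_F F_mem in \<open>auto intro!: F_restrict simp: d_g\<close>)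
  \<comment> \<open>At an index outside \<open>H\<close> two members of a class agree from there
    upwards, before and after overwriting, so the order condition holds. At an index in
    \<open>H\<close> the values are unchanged, and so is agreement above it, because the overwritten
    coordinates were equal and remain equal.\<close>
  have ord: "cle (d x) (d y) \<longleftrightarrow> cle (d (g b x)) (d (g b y))" if "x \<in> X" "y \<in> X" for x y
  proof -
    have C: "x \<in> C" "y \<in> C" and xy: "\<And>p. p \<in> P - H \<Longrightarrow> d x p = d y p" using that a by auto
    have "agree (d (g b x)) (d (g b y)) p \<longleftrightarrow> agree (d x) (d y) p" if "p \<in> P" for p
      using xy unfolding agree_def by (auto simp: d_g b C)
    moreover have "agree (d x) (d y) p" if "p \<in> P - H" for p
      using that H xy unfolding agree_def down_closed_def by blast
    ultimately show ?thesis
      unfolding cle_def using b C by (auto simp: d_g)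
  qed
  note cong = agree_off_congruence[OF H]
  show "lattice_isomorphic (L\<lparr>carrier := X\<rparr>) (L\<lparr>carrier := Y\<rparr>)"
  proof (rule order_iso_imp_lattice_isomorphic)
    show "lattice (L\<lparr>carrier := X\<rparr>)" "lattice (L\<lparr>carrier := Y\<rparr>)"
      using congruence_class_sublattice(1)[OF lattice_L cong] X Y by blast+
    show "bij_betw (g b) (carrier (L\<lparr>carrier := X\<rparr>)) (carrier (L\<lparr>carrier := Y\<rparr>))"
      by (rule bij_betw_byWitness[where f' = "g a"]) (use a b in \<open>auto simp: g_g d_g\<close>)
  qed (use ord in simp)
qed

lemma isoform_lattice_L: "isoform_lattice L"
  unfolding isoform_lattice_def
proof (intro conjI ballI lattice_L)
  fix \<Theta> assume "\<Theta> \<in> carrier (Con L)"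
  then have "lattice_congruence L \<Theta>" by (simp add: Con_def)
  then show "isoform_congruence L \<Theta>" using congruence_is_agree_off isoform_agree_off by blast
qed

end

section \<open>Birkhoff's representation of a finite distributive lattice by down-sets\<close>

context distributive_lattice
begin

text \<open>Requiring some \<open>x\<close> not above \<open>j\<close> excludes the least element,
  so that the empty down-set corresponds to it.\<close>

definition join_primes :: "'a set" where
  "join_primes = {j \<in> carrier L. (\<exists>x\<in>carrier L. \<not> j \<sqsubseteq> x) \<and>
     (\<forall>x\<in>carrier L. \<forall>y\<in>carrier L. j \<sqsubseteq> x \<squnion> y \<longrightarrow> j \<sqsubseteq> x \<or> j \<sqsubseteq> y)}"

definition primes_below :: "'a \<Rightarrow> 'a set" where
  "primes_below x = {j \<in> join_primes. j \<sqsubseteq> x}"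

text \<open>Choose \<open>j\<close> minimal among the elements below \<open>x\<close> but not below
  \<open>y\<close>. If \<open>j\<close> were below \<open>u \<squnion> v\<close> but below neither,
  then \<open>j \<sqinter> u\<close> and \<open>j \<sqinter> v\<close> would be strictly smaller,
  hence below \<open>y\<close>, and distributivity would put \<open>j\<close> below
  \<open>y\<close>.\<close>

lemma separating_join_prime:
  assumes fin: "finite (carrier L)" and x: "x \<in> carrier L" and y: "y \<in> carrier L" and "\<not> x \<sqsubseteq> y"
  shows "\<exists>j\<in>join_primes. j \<sqsubseteq> x \<and> \<not> j \<sqsubseteq> y"
proof -
  define Z where "Z = {z \<in> carrier L. z \<sqsubseteq> x \<and> \<not> z \<sqsubseteq> y}"
  have "\<exists>j\<in>Z. \<forall>z\<in>Z. z \<noteq> j \<longrightarrow> \<not> (z \<sqsubseteq> j \<and> z \<noteq> j)"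
  proof (rule Finite_Set.bex_min_element)
    show "finite Z" using fin by (simp add: Z_def)
    show "Z \<noteq> {}" using assms by (auto simp: Z_def)
    show "asymp_on Z (\<lambda>u v. u \<sqsubseteq> v \<and> u \<noteq> v)"
      by (rule asymp_onI) (auto simp: Z_def)
    show "transp_on Z (\<lambda>u v. u \<sqsubseteq> v \<and> u \<noteq> v)"
      by (rule transp_onI) (use le_trans le_antisym in \<open>unfold Z_def, blast\<close>)
  qed
  then obtain j where jZ: "j \<in> Z" "\<And>z. z \<in> Z \<Longrightarrow> z \<sqsubseteq> j \<Longrightarrow> z = j" by metis
  then have j: "j \<in> carrier L" "j \<sqsubseteq> x" "\<not> j \<sqsubseteq> y" by (simp_all add: Z_def)
  have min: "z \<sqsubseteq> y" if "z \<in> carrier L" "z \<sqsubseteq> j" "z \<noteq> j" "z \<sqsubseteq> x" for z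
    using jZ(2)[of z] that by (auto simp: Z_def)
  have "j \<sqsubseteq> u \<or> j \<sqsubseteq> v" if uv: "u \<in> carrier L" "v \<in> carrier L" "j \<sqsubseteq> u \<squnion> v" for u v
  proof (rule ccontr)
    assume no: "\<not> (j \<sqsubseteq> u \<or> j \<sqsubseteq> v)"
    have small: "j \<sqinter> w \<sqsubseteq> y" if "w \<in> carrier L" "\<not> j \<sqsubseteq> w" for w
    proof (rule min)
      show "j \<sqinter> w \<noteq> j" using that j meet_right by metis
      show "j \<sqinter> w \<sqsubseteq> x" using that j x by (meson le_trans meet_closed meet_left)
    qed (use that j meet_left in auto)
    have "j \<sqsubseteq> j \<sqinter> (u \<squnion> v)" using j uv by (intro meet_le) auto
    also have "j \<sqinter> (u \<squnion> v) = (j \<sqinter> u) \<squnion> (j \<sqinter> v)" using j uv by (intro meet_join_distrib)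
    finally have "j \<sqsubseteq> (j \<sqinter> u) \<squnion> (j \<sqinter> v)" .
    moreover have "(j \<sqinter> u) \<squnion> (j \<sqinter> v) \<sqsubseteq> y"
      using small no uv j y by (intro join_le) auto
    ultimately show False using j uv y by (meson le_trans meet_closed join_closed)
  qed
  then have "j \<in> join_primes" using j y by (auto simp: join_primes_def)
  then show ?thesis using j by blast
qed

lemma primes_below_subset_iff:
  assumes "finite (carrier L)" "x \<in> carrier L" "y \<in> carrier L"
  shows "primes_below x \<subseteq> primes_below y \<longleftrightarrow> x \<sqsubseteq> y"
proof
  show "primes_below x \<subseteq> primes_below y \<Longrightarrow> x \<sqsubseteq> y"
    using separating_join_prime[OF assms] unfolding primes_below_def by blast
  show "x \<sqsubseteq> y \<Longrightarrow> primes_below x \<subseteq> primes_below y"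
    using assms le_trans unfolding primes_below_def join_primes_def by blast
qed

text \<open>The element \<open>x\<close> is the join of \<open>H\<close>, built up by induction over
  finite sets. Primality ensures that a join-prime below the join lies below some member of the
  set.\<close>

lemma downset_is_primes_below:
  assumes fin: "finite (carrier L)" and ne: "carrier L \<noteq> {}" and H: "H \<subseteq> join_primes"
    and down: "\<And>p q. p \<in> H \<Longrightarrow> q \<in> join_primes \<Longrightarrow> q \<sqsubseteq> p \<Longrightarrow> q \<in> H"
  shows "\<exists>x\<in>carrier L. H = primes_below x"
proof -
  have JC: "join_primes \<subseteq> carrier L" by (auto simp: join_primes_def)
  have "\<exists>x\<in>carrier L. (\<forall>h\<in>K. h \<sqsubseteq> x) \<and> (\<forall>j\<in>join_primes. j \<sqsubseteq> x \<longrightarrow> (\<exists>h\<in>K. j \<sqsubseteq> h))"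
    if "finite K" "K \<subseteq> join_primes" for K
    using that
  proof (induction K)
    case empty
    \<comment> \<open>The empty join is the least element, which has no join-prime below it.\<close>
    have "\<Sqinter>carrier L \<in> carrier L" "\<And>x. x \<in> carrier L \<Longrightarrow> \<Sqinter>carrier L \<sqsubseteq> x"
      using finite_inf_greatest[OF fin _ ne] by (auto simp: greatest_def Lower_def)
    then have "\<not> j \<sqsubseteq> \<Sqinter>carrier L" if "j \<in> join_primes" for j
      using that le_trans unfolding join_primes_def by blast
    then show ?case using \<open>\<Sqinter>carrier L \<in> carrier L\<close> by blast
  next
    case (insert k K)
    then obtain x where x: "x \<in> carrier L" "\<forall>h\<in>K. h \<sqsubseteq> x" 
      "\<forall>j\<in>join_primes. j \<sqsubseteq> x \<longrightarrow> (\<exists>h\<in>K. j \<sqsubseteq> h)" by auto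
    have k: "k \<in> carrier L" "K \<subseteq> carrier L" using insert.prems JC by auto
    show ?case
    proof (rule bexI[of _ "k \<squnion> x"], intro conjI ballI impI)
      fix h assume "h \<in> insert k K"
      then show "h \<sqsubseteq> k \<squnion> x"
        using k x join_left[of k x] join_right[of k x] le_trans[of h x "k \<squnion> x"] by auto
    next
      fix j assume j: "j \<in> join_primes" "j \<sqsubseteq> k \<squnion> x"
      then have "j \<sqsubseteq> k \<or> j \<sqsubseteq> x" using k x unfolding join_primes_def by blast
      then show "\<exists>h\<in>insert k K. j \<sqsubseteq> h" using x j by blast
    qed (use k x in auto)
  qed
  moreover have "finite H" using H JC fin by (meson finite_subset)
  ultimately obtain x where x: "x \<in> carrier L" "\<forall>h\<in>H. h \<sqsubseteq> x" 
      "\<forall>j\<in>join_primes. j \<sqsubseteq> x \<longrightarrow> (\<exists>h\<in>H. j \<sqsubseteq> h)" using H by metis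
  then have "H = primes_below x" using H down unfolding primes_below_def by blast
  then show ?thesis using x by blast
qed

end

section \<open>Representation of \<open>D\<close> by a lattice on natural numbers\<close>

theorem theorem1:
  fixes D :: "'a gorder"
  assumes "distributive_lattice D"
    and "finite (carrier D)"
    and "carrier D \<noteq> {}"
  shows "\<exists>L :: nat gorder. isoform_lattice L \<and> finite (carrier L) \<and> carrier L \<noteq> {} \<and>
           lattice_isomorphic (Con L) D"
proof -
  interpret D: distributive_lattice D by fact
  let ?J = "D.join_primes"
  have J: "j \<in> carrier D" if "j \<in> ?J" for j using that by (simp add: D.join_primes_def)
  interpret flat_power ?J "le D" "{..<5::nat}" 0 1
  proof
    show "finite ?J" using assms(2) by (simp add: D.join_primes_def)
    show "p \<sqsubseteq>\<^bsub>D\<^esub> r" if "p \<in> ?J" "q \<in> ?J" "r \<in> ?J" "p \<sqsubseteq>\<^bsub>D\<^esub> q" "q \<sqsubseteq>\<^bsub>D\<^esub> r" for p q r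
      by (rule D.le_trans[OF that(4,5)]) (simp_all add: J that)
    show "p = q" if "p \<in> ?J" "q \<in> ?J" "p \<sqsubseteq>\<^bsub>D\<^esub> q" "q \<sqsubseteq>\<^bsub>D\<^esub> p" for p q
      by (rule D.le_antisym[OF that(3,4)]) (simp_all add: J that)
  qed (simp_all add: J)
  obtain d where d: "bij_betw d {..<card F} F"
    using ex_bij_betw_nat_finite[OF finite_F] by (auto simp: atLeast0LessThan)
  interpret E: flat_power_lattice ?J "le D" "{..<5::nat}" 0 1 "{..<card F}" d
    by unfold_locales (rule d)
  \<comment> \<open>A member of \<open>F\<close> exists even when there are no join-primes, that is,
    when \<open>D\<close> has one element.\<close>
  have "(\<lambda>p\<in>?J. 0) \<in> F" by (rule F_restrict) simp
  then have "0 < card F" using finite_F by (auto simp: card_gt_0_iff)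
  then have "{..<card F} \<noteq> {}" by blast
  moreover have "lattice_isomorphic (Con E.L) D"
  proof (rule order_iso_imp_lattice_isomorphic)
    show "lattice (Con E.L)"
      by (intro complete_lattice_lattice Con_complete_lattice E.lattice_L)
    \<comment> \<open>Birkhoff's map followed by \<open>agree_off\<close>. It leads from
      \<open>D\<close> to \<open>Con E.L\<close>, so its inverse is the isomorphism asked
      for.\<close>
    let ?g = "\<lambda>x. E.agree_off (D.primes_below x)"
    have closed: "E.down_closed (D.primes_below x)" if "x \<in> carrier D" for x
      using D.le_trans[of _ _ x] that J by (auto simp: E.down_closed_def D.primes_below_def)
    have ord: "?g x \<subseteq> ?g y \<longleftrightarrow> x \<sqsubseteq>\<^bsub>D\<^esub> y" if "x \<in> carrier D" "y \<in> carrier D" for x y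
      using that closed assms(2) by (simp add: E.agree_off_subset_iff D.primes_below_subset_iff E.down_closed_def)
    have g: "bij_betw ?g (carrier D) (carrier (Con E.L))"
      unfolding bij_betw_def
    proof
      show "inj_on ?g (carrier D)"
      proof (rule inj_onI)
        fix x y assume xy: "x \<in> carrier D" "y \<in> carrier D" "?g x = ?g y"
        then show "x = y" using ord[of x y] ord[of y x] by (intro D.le_antisym) simp_all
      qed
      have "\<exists>x\<in>carrier D. \<Theta> = ?g x" if cong: "lattice_congruence E.L \<Theta>" for \<Theta>
      proof -
        obtain H where H: "E.down_closed H" "\<Theta> = E.agree_off H"
          using E.congruence_is_agree_off[OF cong] by blast
        then obtain x where "x \<in> carrier D" "H = D.primes_below x"
          using D.downset_is_primes_below[OF assms(2,3), of H] by (auto simp: E.down_closed_def)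
        then show ?thesis using H by blast
      qed
      then show "?g ` carrier D = carrier (Con E.L)"
        using closed E.agree_off_congruence by (auto simp: Con_def)
    qed
    show "bij_betw (inv_into (carrier D) ?g) (carrier (Con E.L)) (carrier D)"
      using g by (rule bij_betw_inv_into)
    show "\<Theta> \<sqsubseteq>\<^bsub>Con E.L\<^esub> \<Psi> \<longleftrightarrow> 
        inv_into (carrier D) ?g \<Theta> \<sqsubseteq>\<^bsub>D\<^esub> inv_into (carrier D) ?g \<Psi>"
      if \<Theta>\<Psi>: "\<Theta> \<in> carrier (Con E.L)" "\<Psi> \<in> carrier (Con E.L)" for \<Theta> \<Psi>
    proof -
      note right = bij_betw_inv_into_right[OF g \<Theta>\<Psi>(1)] bij_betw_inv_into_right[OF g \<Theta>\<Psi>(2)]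
      have "inv_into (carrier D) ?g \<Theta> \<in> carrier D" "inv_into (carrier D) ?g \<Psi> \<in> carrier D"
        using bij_betwE[OF bij_betw_inv_into[OF g]] \<Theta>\<Psi> by blast+
      from ord[OF this] show ?thesis by (simp add: right) (simp add: Con_def)
    qed
  qed (rule D.lattice_axioms)
  ultimately show ?thesis
    using E.isoform_lattice_L 
    by (intro exI[of _ E.L] conjI) (simp_all only: E.L_simps(1) finite_lessThan not_False_eq_True)
qed

end
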